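(* Let $f:2^{\mathcal N}\to\mathbb R_{\ge0}$ be a non-negative (not necessarily monotone) submodular function and $\mathcal M=(\mathcal N,\mathcal I)$ a matroid. The Residual Random Greedy algorithm achieves an approximation guarantee of approximately $0.27493$ (namely $\frac{1}{\sqrt5}\big(e^{-ax^*}-e^{-bx^*}\big)$ with $a=\frac{3-\sqrt5}{2}$, $b=\frac{3+\sqrt5}{2}$, $x^*=\frac{\ln(b/a)}{\sqrt5}$) for the problem $\max\{f(S): S\in\mathcal I\}$, i.e., the expected value of its output is at least this constant times $\max\{f(S):S\in\mathcal I\}$.
   Context: A set function $f$ is submodular if $f(A\cup B)+f(A\cap B)\le f(A)+f(B)$ for all $A,B\subseteq\mathcal N$. For an independent set $S$, the contracted matroid $\mathcal M/S$ has ground set $\mathcal N\setminus S$, and $S'\subseteq\mathcal N\setminus S$ is independent in it iff $S'\cup S\in\mathcal I$. The Residual Random Greedy (RRG) algorithm (Buchbinder–Feldman–Naor–Schwartz): let $k$ be the rank of $\mathcal M$, where the ground set is padded with dummy elements contributing zero to $f$ so that bases exist of the relevant sizes (a copy $u'$ of each $u\in\mathcal N$, with $u,u'$ not both allowed, a set independent iff its projection to $\mathcal N$ is independent, and $f(S)$ depending only on $S\cap\mathcal N$). Start with $S_0=\emptyset$; for $i=1,\dots,k$, let $M_i$ be a base of $\mathcal M/S_{i-1}$ maximizing $\sum_{u\in M_i}[f(S_{i-1}\cup\{u\})-f(S_{i-1})]$, pick $u_i$ uniformly at random from $M_i$ and set $S_i=S_{i-1}\cup\{u_i\}$; output $S_k$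 restricted to the original elements. *)

theory Defs
  imports "HOL-Probability.Probability"
begin

definition matroid :: "'a set \<Rightarrow> 'a set set \<Rightarrow> bool" where
  "matroid N I \<longleftrightarrow> finite N \<and> I \<subseteq> Pow N \<and> {} \<in> I \<and>
     (\<forall>A\<in>I. \<forall>B. B \<subseteq> A \<longrightarrow> B \<in> I) \<and>
     (\<forall>A\<in>I. \<forall>B\<in>I. card A < card B \<longrightarrow> (\<exists>x\<in>B - A. insert x A \<in> I))"

definition submodular_on :: "'a set \<Rightarrow> ('a set \<Rightarrow> real) \<Rightarrow> bool" where
  "submodular_on N f \<longleftrightarrow>
     (\<forall>A B. A \<subseteq> N \<longrightarrow> B \<subseteq> N \<longrightarrow> f (A \<union> B) + f (A \<inter> B) \<le> f A + f B)"

definition mrank :: "'a set set \<Rightarrow> nat" where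
  "mrank I = Max (card ` I)"

text \<open>Padded ground set: (u,False) is the original element u, (u,True) its dummy copy u'.\<close>
definition pad_ground :: "'a set \<Rightarrow> ('a \<times> bool) set" where
  "pad_ground N = N \<times> UNIV"

definition orig :: "('a \<times> bool) set \<Rightarrow> 'a set" where
  "orig S = {u. (u, False) \<in> S}"

definition pad_indep :: "'a set \<Rightarrow> 'a set set \<Rightarrow> ('a \<times> bool) set \<Rightarrow> bool" where
  "pad_indep N I S \<longleftrightarrow> S \<subseteq> pad_ground N \<and>
     (\<forall>u. \<not> ((u, False) \<in> S \<and> (u, True) \<in> S)) \<and> fst ` S \<in> I"

definition pad_f :: "('a set \<Rightarrow> real) \<Rightarrow> ('a \<times> bool) set \<Rightarrow> real" where
  "pad_f f S = f (orig S)"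

definition contr_base :: "'a set \<Rightarrow> 'a set set \<Rightarrow> ('a \<times> bool) set \<Rightarrow> ('a \<times> bool) set \<Rightarrow> bool" where
  "contr_base N I S B \<longleftrightarrow> B \<subseteq> pad_ground N - S \<and> pad_indep N I (B \<union> S) \<and>
     (\<forall>x \<in> pad_ground N - S - B. \<not> pad_indep N I (insert x (B \<union> S)))"

definition marg_weight :: "('a set \<Rightarrow> real) \<Rightarrow> ('a \<times> bool) set \<Rightarrow> ('a \<times> bool) set \<Rightarrow> real" where
  "marg_weight f S B = (\<Sum>u\<in>B. pad_f f (insert u S) - pad_f f S)"

text \<open>A valid choice rule: given the history of picked elements (most recent first),
  it returns a base of the contraction by the picked set maximising the total marginal gain.
  Arbitrary tie-breaking (possibly history-dependent) is allowed.\<close>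
definition valid_rrg_choice :: "'a set \<Rightarrow> 'a set set \<Rightarrow> ('a set \<Rightarrow> real)
     \<Rightarrow> (('a \<times> bool) list \<Rightarrow> ('a \<times> bool) set) \<Rightarrow> bool" where
  "valid_rrg_choice N I f sel \<longleftrightarrow>
     (\<forall>h. distinct h \<and> pad_indep N I (set h) \<and> length h < mrank I \<longrightarrow>
        contr_base N I (set h) (sel h) \<and>
        (\<forall>B. contr_base N I (set h) B \<longrightarrow> marg_weight f (set h) B \<le> marg_weight f (set h) (sel h)))"

fun rrg_run :: "(('a \<times> bool) list \<Rightarrow> ('a \<times> bool) set) \<Rightarrow> nat \<Rightarrow> ('a \<times> bool) list
     \<Rightarrow> ('a \<times> bool) list pmf" where
  "rrg_run sel 0 h = return_pmf h"
| "rrg_run sel (Suc n) h = pmf_of_set (sel h) \<bind> (\<lambda>u. rrg_run sel n (u # h))"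

definition rrg_output :: "'a set set \<Rightarrow> (('a \<times> bool) list \<Rightarrow> ('a \<times> bool) set) \<Rightarrow> 'a set pmf" where
  "rrg_output I sel = map_pmf (\<lambda>h. orig (set h)) (rrg_run sel (mrank I) [])"

definition rrg_const :: real where
  "rrg_const = (let a = (3 - sqrt 5) / 2; b = (3 + sqrt 5) / 2; x = ln (b / a) / sqrt 5
                in (1 / sqrt 5) * (exp (- a * x) - exp (- b * x)))"

end

theory Submission
  imports Defs
begin

text \<open>
Let \<open>H(S)\<close> be the largest value of a base of the padded matroid that contains \<open>S\<close>. If \<open>m\<close> steps remain
and \<open>u\<close> is the random element picked next, then
  \<open>E f(S + u) \<ge> (1 - 1/m) f(S) + H(S) / m\<close>  and  \<open>E H(S + u) \<ge> (1 - 2/m) H(S) + f(S) / m\<close>.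
The first inequality compares the greedy base with the best one. For the second, an exchange
bijection \<open>g\<close> from the greedy base to the best base \<open>T\<close> gives \<open>H(S + u) \<ge> f(T - g u + u)\<close>, and
submodularity bounds the average of the right-hand side; the term \<open>f(S) / m\<close> survives because
dummies allow parts of \<open>T\<close> to be discarded, so no part of the optimal \<open>T\<close> hurts \<open>S\<close>.

Hence lower bounds \<open>\<alpha> f(S) + \<beta> H(S)\<close> on the expected output propagate backwards through the run by
\<open>(\<alpha>, \<beta>) \<mapsto> (1 + A / m) (\<alpha>, \<beta>)\<close> with \<open>A = ((-1, 1), (1, -2))\<close>, whose eigenvalues are \<open>-a\<close> and \<open>-b\<close>. One may
start from \<open>(1, 0)\<close> at any time, and also from a mixture of \<open>(1, 0)\<close> and its successor. So after \<open>k\<close>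
steps \<open>\<beta> = (P - Q) / sqrt 5\<close>, where \<open>P\<close> and \<open>Q\<close> are products of factors \<open>1 - a t\<close> and \<open>1 - b t\<close>, and
for \<open>k \<ge> 4\<close> the mixture can be tuned to make \<open>P = exp (- a x)\<close> for the optimal \<open>x\<close>. Bernoulli's inequality gives
\<open>Q \<le> P powr (b / a) = exp (- b x)\<close>. For \<open>k \<le> 3\<close> a single step already suffices.
\<close>

subsection \<open>Exchange bijections in matroids\<close>

lemma card_swap: "finite A \<Longrightarrow> x \<in> A \<Longrightarrow> y \<notin> A \<Longrightarrow> card (insert y (A - {x})) = card A"
  by (metis Diff_iff card_Suc_Diff1 card_insert_disjoint finite_Diff)

lemma matroid_ground: "matroid N I \<Longrightarrow> A \<in> I \<Longrightarrow> A \<subseteq> N"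
  unfolding matroid_def by blast

lemma matroid_finite: "matroid N I \<Longrightarrow> A \<in> I \<Longrightarrow> finite A"
  unfolding matroid_def by (meson PowD finite_subset subsetD)

lemma matroid_subset: "matroid N I \<Longrightarrow> A \<in> I \<Longrightarrow> B \<subseteq> A \<Longrightarrow> B \<in> I"
  unfolding matroid_def by blast

lemma matroid_augment:
  "matroid N I \<Longrightarrow> A \<in> I \<Longrightarrow> B \<in> I \<Longrightarrow> card A < card B \<Longrightarrow> \<exists>x\<in>B - A. insert x A \<in> I"
  unfolding matroid_def by blast

lemma matroid_finite_indep: "matroid N I \<Longrightarrow> finite I"
  unfolding matroid_def by (meson finite_Pow_iff finite_subset)

lemma card_le_mrank: "matroid N I \<Longrightarrow> A \<in> I \<Longrightarrow> card A \<le> mrank I"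
  unfolding mrank_def by (intro Max_ge) (auto dest: matroid_finite_indep)

lemma mrank_attained: "matroid N I \<Longrightarrow> \<exists>A\<in>I. card A = mrank I"
proof -
  assume m: "matroid N I"
  then have "Max (card ` I) \<in> card ` I"
    using matroid_finite_indep[OF m] by (intro Max_in) (auto simp: matroid_def)
  then show ?thesis unfolding mrank_def by auto
qed

text \<open>Repeated augmentation from \<open>B\<close>. The inclusion
  \<open>C \<subseteq> A \<union> B\<close> controls where the new elements come from, which the
  exchange argument relies on.\<close>

lemma matroid_extend:
  assumes m: "matroid N I" and A: "A \<in> I" and B: "B \<in> I" and le: "card A \<le> card B"
  shows "\<exists>C\<in>I. A \<subseteq> C \<and> C \<subseteq> A \<union> B \<and> card C = card B"
  using A le
proof (induction "card B - card A" arbitrary: A)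
  case 0
  then show ?case by auto
next
  case (Suc n)
  then have "card A < card B" by simp
  then obtain x where x: "x \<in> B - A" "insert x A \<in> I"
    using matroid_augment[OF m] Suc.prems B by blast
  have c: "card (insert x A) = Suc (card A)"
    using x matroid_finite[OF m Suc.prems(1)] by simp
  obtain C where "C \<in> I" "insert x A \<subseteq> C" "C \<subseteq> insert x A \<union> B" "card C = card B"
    using Suc.hyps(1)[of "insert x A"] Suc.hyps(2) x(2) c \<open>card A < card B\<close> by force
  then show ?case using x by blast
qed

text \<open>By contradiction, with \<open>U\<close> the elements of \<open>X\<close> replaceable by
  \<open>b\<close>. If none of them can replace \<open>b\<close> in \<open>Y\<close>, then
  \<open>(Y - {b}) \<union> U\<close> has rank below \<open>card Y\<close>, so an independent set of
  size \<open>card Y - 1\<close> in it that contains \<open>U\<close> can be augmented from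
  \<open>Y\<close> only by \<open>b\<close>. Hence \<open>insert b U\<close> is independent;
  completing it from \<open>X\<close> omits some element of \<open>X\<close> outside
  \<open>U\<close>, which is then replaceable by \<open>b\<close> after all.\<close>

lemma symmetric_exchange:
  assumes m: "matroid N I" and X: "X \<in> I" and Y: "Y \<in> I" and card: "card X = card Y"
    and b: "b \<in> Y - X"
  shows "\<exists>u\<in>X - Y. insert b (X - {u}) \<in> I \<and> insert u (Y - {b}) \<in> I"
proof (rule ccontr)
  assume no: "\<not> ?thesis"
  \<comment> \<open>If \<open>insert b X\<close> is dependent, \<open>U\<close> is its circuit
    through \<open>b\<close> without \<open>b\<close> itself.\<close>
  define U where "U = {u \<in> X. insert b (X - {u}) \<in> I}"
  have fX: "finite X" and fY: "finite Y" using matroid_finite[OF m] X Y by auto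
  have Yb: "Y - {b} \<in> I" by (rule matroid_subset[OF m Y]) simp
  have cYb: "card (Y - {b}) < card Y" using b fY by (intro card_Diff1_less) auto
  have W: "insert x (Y - {b}) \<notin> I" if "x \<in> U" "x \<notin> Y - {b}" for x
    using no that b unfolding U_def by blast
  have small: "card J < card Y" if J: "J \<in> I" "J \<subseteq> (Y - {b}) \<union> U" for J
  proof (rule ccontr)
    assume "\<not> card J < card Y"
    then have "card (Y - {b}) < card J" using cYb by linarith
    then obtain x where "x \<in> J - (Y - {b})" "insert x (Y - {b}) \<in> I"
      using matroid_augment[OF m Yb J(1)] by blast
    then show False using W J(2) by blast
  qed
  have UX: "U \<subseteq> X" unfolding U_def by blast
  then have UI: "U \<in> I" by (rule matroid_subset[OF m X])
  have "card U < card Y" using small[OF UI] by blast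
  then have "card U \<le> card (Y - {b})" using b fY by simp
  then obtain J where J: "J \<in> I" "U \<subseteq> J" "J \<subseteq> U \<union> (Y - {b})" "card J = card (Y - {b})"
    using matroid_extend[OF m UI Yb] by blast
  then obtain x where x: "x \<in> Y - J" "insert x J \<in> I"
    using matroid_augment[OF m J(1) Y] cYb by auto
  have "x = b"
  proof (rule ccontr)
    assume "x \<noteq> b"
    then have "card (insert x J) < card Y" using x J by (intro small) auto
    moreover have "card (insert x J) = Suc (card J)"
      using x matroid_finite[OF m J(1)] by simp
    ultimately show False using J(4) b fY by simp
  qed
  then have Ub: "insert b U \<in> I" using J(2) by (intro matroid_subset[OF m x(2)]) auto
  have "card (insert b U) \<le> card X"
    using \<open>card U < card Y\<close> card by (simp add: card_insert_if finite_subset[OF UX fX])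
  then obtain C where C: "C \<in> I" "insert b U \<subseteq> C" "C \<subseteq> insert b U \<union> X" "card C = card X"
    using matroid_extend[OF m Ub X] by blast
  have "\<not> X \<subseteq> C"
  proof
    assume "X \<subseteq> C"
    then have "X = C" using C matroid_finite[OF m C(1)] by (metis card_subset_eq)
    then show False using C(2) b by blast
  qed
  then obtain u where u: "u \<in> X" "u \<notin> C" by blast
  have fC: "finite C" using matroid_finite[OF m C(1)] .
  have "C \<subseteq> insert b (X - {u})" using C(3) u UX by blast
  moreover have "card (insert b (X - {u})) = card C"
    using u b fX C(4) card_swap[of X u b] by auto
  ultimately have "C = insert b (X - {u})" using fX by (intro card_subset_eq) auto
  then have "u \<in> U" using C(1) u unfolding U_def by auto
  then show False using u C(2) by blast
qed

text \<open>Induction that moves \<open>X\<close> towards \<open>Y\<close> one symmetric exchange at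
  a time. One half of the exchange keeps \<open>X\<close> independent, the other records the pair
  \<open>u\<close>, \<open>b\<close>. All recorded exchanges concern the fixed set \<open>Y\<close>,
  so they survive later changes of \<open>X\<close>.\<close>

lemma exchange_bijection:
  assumes m: "matroid N I" and X: "X \<in> I" and Y: "Y \<in> I" and card: "card X = card Y"
  shows "\<exists>g. bij_betw g (X - Y) (Y - X) \<and> (\<forall>u\<in>X - Y. insert u (Y - {g u}) \<in> I)"
  using X card
proof (induction "card (Y - X)" arbitrary: X)
  case 0
  have "finite Y" using matroid_finite[OF m Y] .
  then have "Y \<subseteq> X" using 0 by simp
  then have "X = Y" using 0 matroid_finite[OF m] by (metis card_subset_eq)
  then show ?case by (auto simp: bij_betw_def)
next
  case (Suc n)
  have fX: "finite X" and fY: "finite Y" using matroid_finite[OF m] Suc.prems Y by auto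
  obtain b where b: "b \<in> Y - X" using Suc.hyps(2) by (metis card.empty ex_in_conv nat.distinct(1))
  obtain u where u: "u \<in> X - Y" "insert b (X - {u}) \<in> I" "insert u (Y - {b}) \<in> I"
    using symmetric_exchange[OF m Suc.prems(1) Y Suc.prems(2) b] by blast
  let ?X = "insert b (X - {u})"
  have d1: "Y - ?X = (Y - X) - {b}" and d2: "?X - Y = (X - Y) - {u}" using u b by auto
  have "card ?X = card Y" using u b fX Suc.prems(2) card_swap[of X u b] by auto
  moreover have "n = card (Y - ?X)" using Suc.hyps(2) b fY unfolding d1 by simp
  ultimately obtain g where g: "bij_betw g (?X - Y) (Y - ?X)"
    "\<forall>v\<in>?X - Y. insert v (Y - {g v}) \<in> I"
    using Suc.hyps(1)[of ?X] u by blast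
  have g': "bij_betw g ((X - Y) - {u}) ((Y - X) - {b})"
    using g(1) unfolding d1 d2 .
  have "bij_betw (g(u := b)) ((X - Y) - {u}) ((Y - X) - {b})"
    using g' by (rule bij_betw_cong[THEN iffD1, rotated]) auto
  then have "bij_betw (g(u := b)) (insert u ((X - Y) - {u})) (insert b ((Y - X) - {b}))"
    using notIn_Un_bij_betw[of u "(X - Y) - {u}" "g(u := b)" "(Y - X) - {b}"] by simp
  moreover have "insert u ((X - Y) - {u}) = X - Y" "insert b ((Y - X) - {b}) = Y - X"
    using u b by auto
  moreover have "insert v (Y - {(g(u := b)) v}) \<in> I" if "v \<in> X - Y" for v
    using that g(2) u unfolding d2 by auto
  ultimately show ?case by auto
qed

subsection \<open>One step of the greedy algorithm\<close>

lemma submodular_onD: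
  "submodular_on N f \<Longrightarrow> A \<subseteq> N \<Longrightarrow> B \<subseteq> N \<Longrightarrow> f (A \<union> B) + f (A \<inter> B) \<le> f A + f B"
  unfolding submodular_on_def by blast

lemma submodular_sum_insert:
  assumes sub: "submodular_on N f" and A: "A \<subseteq> N" and "finite D" "D \<subseteq> N" "D \<inter> A = {}"
  shows "f (A \<union> D) - f A \<le> (\<Sum>u\<in>D. f (insert u A) - f A)"
  using assms(3-)
proof (induction D rule: finite_induct)
  case (insert x D)
  have "f (insert x A \<union> (A \<union> D)) + f (insert x A \<inter> (A \<union> D)) \<le> f (insert x A) + f (A \<union> D)"
    using insert A by (intro submodular_onD[OF sub]) auto
  moreover have "insert x A \<union> (A \<union> D) = A \<union> insert x D" "insert x A \<inter> (A \<union> D) = A"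
    using insert by auto
  ultimately show ?case using insert by simp
qed simp

lemma submodular_sum_remove:
  assumes sub: "submodular_on N f" and A: "A \<subseteq> N" and "finite D" "D \<subseteq> A"
  shows "f (A - D) - f A \<le> (\<Sum>u\<in>D. f (A - {u}) - f A)"
  using assms(3-)
proof (induction D rule: finite_induct)
  case (insert x D)
  have "f ((A - {x}) \<union> (A - D)) + f ((A - {x}) \<inter> (A - D)) \<le> f (A - {x}) + f (A - D)"
    using insert A by (intro submodular_onD[OF sub]) auto
  moreover have "(A - {x}) \<union> (A - D) = A" "(A - {x}) \<inter> (A - D) = A - insert x D"
    using insert by auto
  ultimately show ?case using insert by simp
qed simp

text \<open>The assumption \<open>discard\<close> is all that is needed of the dummy elements.\<close>
locale discardable_matroid =
  fixes N :: "'a set" and I :: "'a set set" and f :: "'a set \<Rightarrow> real"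
  assumes matroid: "matroid N I"
    and nonneg: "A \<subseteq> N \<Longrightarrow> 0 \<le> f A"
    and submodular: "submodular_on N f"
    and discard: "T \<in> I \<Longrightarrow> C \<subseteq> T \<Longrightarrow> \<exists>T'\<in>I. T - C \<subseteq> T' \<and> card T' = card T \<and> f T' = f (T - C)"
begin

definition bases_above :: "'a set \<Rightarrow> 'a set set" where
  "bases_above S = {T \<in> I. S \<subseteq> T \<and> card T = mrank I}"

text \<open>The potential \<open>H(S)\<close>. It is meaningful for independent \<open>S\<close>
  only, where the maximum ranges over a nonempty set.\<close>

definition opt_above :: "'a set \<Rightarrow> real" where
  "opt_above S = Max (f ` bases_above S)"

lemma finite_bases_above: "finite (bases_above S)"
  using matroid_finite_indep[OF matroid] unfolding bases_above_def by simp

lemma bases_above_nonempty: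
  assumes "S \<in> I" shows "bases_above S \<noteq> {}"
proof -
  obtain B where B: "B \<in> I" "card B = mrank I" using mrank_attained[OF matroid] by blast
  then obtain C where "C \<in> I" "S \<subseteq> C" "card C = card B"
    using matroid_extend[OF matroid assms, of B] card_le_mrank[OF matroid assms] by auto
  then show ?thesis using B unfolding bases_above_def by auto
qed

lemma opt_above_ge: "T \<in> bases_above S \<Longrightarrow> f T \<le> opt_above S"
  unfolding opt_above_def by (simp add: finite_bases_above)

lemma opt_above_attained:
  assumes "S \<in> I" obtains T where "T \<in> bases_above S" "opt_above S = f T"
proof -
  have "opt_above S \<in> f ` bases_above S"
    unfolding opt_above_def
    by (intro Max_in) (use bases_above_nonempty[OF assms] finite_bases_above in auto)
  then show ?thesis using that by blast
qed

text \<open>From any base above \<open>S\<close>, everything outside \<open>S\<close> can be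
  discarded.\<close>

lemma opt_above_ge_self:
  assumes S: "S \<in> I" shows "f S \<le> opt_above S"
proof -
  obtain T where T: "T \<in> bases_above S" using bases_above_nonempty[OF S] by blast
  then obtain T' where "T' \<in> I" "T - (T - S) \<subseteq> T'" "card T' = card T" "f T' = f (T - (T - S))"
    using discard[of T "T - S"] unfolding bases_above_def by blast
  moreover have "T - (T - S) = S" using T unfolding bases_above_def by blast
  ultimately show ?thesis using opt_above_ge[of T' S] T unfolding bases_above_def by simp
qed

text \<open>If adding \<open>C\<close> to \<open>S\<close> decreased the value, discarding \<open>C\<close> would improve the optimal base.\<close>
lemma opt_part_ge:
  assumes T: "T \<in> bases_above S" "opt_above S = f T" and C: "C \<subseteq> T - S"
  shows "f S \<le> f (S \<union> C)"
proof -
  have TI: "T \<in> I" "S \<subseteq> T" using T unfolding bases_above_def by auto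
  obtain T' where T': "T' \<in> I" "T - C \<subseteq> T'" "card T' = card T" "f T' = f (T - C)"
    using discard[of T C] TI C by blast
  then have "f (T - C) \<le> f T"
    using opt_above_ge[of T' S] T C TI unfolding bases_above_def by auto
  moreover have "f ((T - C) \<union> (S \<union> C)) + f ((T - C) \<inter> (S \<union> C)) \<le> f (T - C) + f (S \<union> C)"
    using matroid_ground[OF matroid TI(1)] C TI by (intro submodular_onD[OF submodular]) auto
  moreover have "(T - C) \<union> (S \<union> C) = T" "(T - C) \<inter> (S \<union> C) = S"
    using C TI by auto
  ultimately show ?thesis by simp
qed

text \<open>For \<open>u\<close> in \<open>X - T\<close> the base \<open>T - g u + u\<close>
  competes for \<open>opt_above (insert u S)\<close>, and for \<open>u\<close> in
  \<open>X \<inter> T\<close> the base \<open>T\<close> itself does. Summed over \<open>u\<close>,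
  the insertions lose at most \<open>f T\<close> and the deletions at most
  \<open>f T - f S\<close>.\<close>

lemma sum_opt_above_ge:
  assumes X: "X \<in> bases_above S"
  shows "(real (card (X - S)) - 2) * opt_above S + f S \<le> (\<Sum>u\<in>X - S. opt_above (insert u S))"
proof -
  have XI: "X \<in> I" "S \<subseteq> X" "card X = mrank I" using X unfolding bases_above_def by auto
  have SI: "S \<in> I" using matroid_subset[OF matroid XI(1,2)] .
  obtain T where T: "T \<in> bases_above S" "opt_above S = f T" using opt_above_attained[OF SI] .
  have TI: "T \<in> I" "S \<subseteq> T" "card T = mrank I" using T unfolding bases_above_def by auto
  have fin: "finite X" "finite T" using matroid_finite[OF matroid] XI TI by auto
  have ground: "X \<subseteq> N" "T \<subseteq> N" using matroid_ground[OF matroid] XI TI by auto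
  obtain g where g: "bij_betw g (X - T) (T - X)" "\<And>u. u \<in> X - T \<Longrightarrow> insert u (T - {g u}) \<in> I"
    using exchange_bijection[OF matroid XI(1) TI(1)] XI TI by auto
  have gm: "g u \<in> T - X" if "u \<in> X - T" for u using g(1) that by (rule bij_betwE[THEN bspec])
  have swap: "f T + (f (insert u T) - f T) + (f (T - {g u}) - f T) \<le> opt_above (insert u S)"
    if u: "u \<in> X - T" for u
  proof -
    have "card (insert u (T - {g u})) = card T"
      using u gm[OF u] fin card_swap[of T "g u" u] by auto
    then have "insert u (T - {g u}) \<in> bases_above (insert u S)"
      using g(2)[OF u] u gm[OF u] TI XI unfolding bases_above_def by auto
    then have "f (insert u (T - {g u})) \<le> opt_above (insert u S)" by (rule opt_above_ge)
    moreover have "f (insert u (T - {g u}) \<union> T) + f (insert u (T - {g u}) \<inter> T)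
        \<le> f (insert u (T - {g u})) + f T"
      using u ground by (intro submodular_onD[OF submodular]) auto
    moreover have "insert u (T - {g u}) \<union> T = insert u T" "insert u (T - {g u}) \<inter> T = T - {g u}"
      using u gm[OF u] by auto
    ultimately show ?thesis by simp
  qed
  have keep: "f T \<le> opt_above (insert u S)" if "u \<in> (X \<inter> T) - S" for u
    using that TI by (intro opt_above_ge) (auto simp: bases_above_def)
  \<comment> \<open>Nonnegativity enters here: adding all of \<open>X - T\<close> to
    \<open>T\<close> loses at most \<open>f T\<close>.\<close>
  have "- f T \<le> f (T \<union> (X - T)) - f T" using nonneg[of "T \<union> (X - T)"] ground by auto
  also have "\<dots> \<le> (\<Sum>u\<in>X - T. f (insert u T) - f T)"
    using ground fin by (intro submodular_sum_insert[OF submodular]) auto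
  finally have add: "- f T \<le> (\<Sum>u\<in>X - T. f (insert u T) - f T)" .
  \<comment> \<open>Deleting all of \<open>T - X\<close> leaves \<open>S\<close> and a part of the
    optimal base, so the remaining value is at least \<open>f S\<close>.\<close>
  have "T - (T - X) = S \<union> (X \<inter> T - S)" using XI TI by auto
  then have "f S - f T \<le> f (T - (T - X)) - f T"
    using opt_part_ge[OF T, of "X \<inter> T - S"] by auto
  also have "\<dots> \<le> (\<Sum>v\<in>T - X. f (T - {v}) - f T)"
    using ground fin by (intro submodular_sum_remove[OF submodular]) auto
  also have "\<dots> = (\<Sum>u\<in>X - T. f (T - {g u}) - f T)"
    using sum.reindex_bij_betw[OF g(1), of "\<lambda>v. f (T - {v}) - f T"] by simp
  finally have del: "f S - f T \<le> (\<Sum>u\<in>X - T. f (T - {g u}) - f T)" .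
  have split: "X - S = (X - T) \<union> ((X \<inter> T) - S)" using TI XI by auto
  have "card (X - S) = card (X - T) + card ((X \<inter> T) - S)"
    unfolding split using fin by (intro card_Un_disjoint) auto
  then have c: "real (card (X - S)) = real (card (X - T)) + real (card ((X \<inter> T) - S))" by simp
  have "(real (card (X - S)) - 2) * opt_above S + f S
      = (real (card (X - T)) * f T - f T + (f S - f T)) + real (card ((X \<inter> T) - S)) * f T"
    unfolding c T(2) by (simp add: algebra_simps)
  also have "\<dots> \<le> (\<Sum>u\<in>X - T. f T + (f (insert u T) - f T) + (f (T - {g u}) - f T))
      + (\<Sum>u\<in>(X \<inter> T) - S. f T)"
    using add del unfolding sum.distrib by simp
  also have "\<dots> \<le> (\<Sum>u\<in>X - T. opt_above (insert u S)) + (\<Sum>u\<in>(X \<inter> T) - S. opt_above (insert u S))"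
    by (intro add_mono sum_mono swap keep)
  also have "\<dots> = (\<Sum>u\<in>X - S. opt_above (insert u S))"
    unfolding split using fin by (intro sum.union_disjoint[symmetric]) auto
  finally show ?thesis .
qed

text \<open>The total marginal gain of \<open>X\<close> is at least that of an optimal base
  \<open>T\<close>, which by submodularity is at least \<open>f T - f S\<close>.\<close>

lemma sum_greedy_ge:
  assumes X: "X \<in> bases_above S"
    and greedy: "\<And>Y. Y \<in> bases_above S \<Longrightarrow>
      (\<Sum>u\<in>Y - S. f (insert u S) - f S) \<le> (\<Sum>u\<in>X - S. f (insert u S) - f S)"
  shows "(real (card (X - S)) - 1) * f S + opt_above S \<le> (\<Sum>u\<in>X - S. f (insert u S))"
proof -
  have SI: "S \<in> I" using matroid_subset[OF matroid] X unfolding bases_above_def by blast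
  obtain T where T: "T \<in> bases_above S" "opt_above S = f T" using opt_above_attained[OF SI] .
  have TI: "T \<in> I" "S \<subseteq> T" using T unfolding bases_above_def by auto
  have "S \<union> (T - S) = T" using TI by blast
  then have "f T - f S = f (S \<union> (T - S)) - f S" by simp
  also have "\<dots> \<le> (\<Sum>u\<in>T - S. f (insert u S) - f S)"
    using TI matroid_finite[OF matroid TI(1)] matroid_ground[OF matroid TI(1)]
    by (intro submodular_sum_insert[OF submodular]) auto
  also have "\<dots> \<le> (\<Sum>u\<in>X - S. f (insert u S) - f S)" using greedy[OF T(1)] .
  finally show ?thesis unfolding T(2) by (simp add: sum_subtractf algebra_simps)
qed

end


subsection \<open>The recursion for the coefficients\<close>

text \<open>\<open>rrg_bound n \<alpha> \<beta>\<close>: with \<open>n\<close> steps left, the expected output is at least \<open>\<alpha> f(S) + \<beta> H(S)\<close>.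
  In \<open>start\<close>, the vector \<open>(1 - s, s)\<close> is a mixture of \<open>(1, 0)\<close> and its image under a full step.\<close>
inductive rrg_bound :: "nat \<Rightarrow> real \<Rightarrow> real \<Rightarrow> bool" where
  zero: "rrg_bound 0 0 1"
| start: "1 \<le> n \<Longrightarrow> 0 \<le> s \<Longrightarrow> s * real n \<le> 1 \<Longrightarrow> rrg_bound n (1 - s) s"
| step: "1 \<le> n \<Longrightarrow> rrg_bound n \<alpha> \<beta> \<Longrightarrow>
    rrg_bound (Suc n) (\<alpha> * (1 - 1 / real (Suc n)) + \<beta> / real (Suc n))
      (\<alpha> / real (Suc n) + \<beta> * (1 - 2 / real (Suc n)))"

text \<open>Nonnegative coefficients allow the two one-step inequalities to be combined. The premise
  \<open>1 \<le> n\<close> of \<open>step\<close> makes \<open>1 - 2 / real (Suc n)\<close>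
  nonnegative.\<close>

lemma rrg_bound_nonneg: "rrg_bound n \<alpha> \<beta> \<Longrightarrow> 0 \<le> \<alpha> \<and> 0 \<le> \<beta>"
proof (induction rule: rrg_bound.induct)
  case (start n s)
  have "s * 1 \<le> s * real n" using start by (intro mult_left_mono) auto
  then show ?case using start by simp
next
  case (step n \<alpha> \<beta>)
  then have "0 \<le> 1 - 1 / real (Suc n)" "0 \<le> 1 - 2 / real (Suc n)" by (auto simp: field_simps)
  then show ?case using step by (auto intro!: add_nonneg_nonneg mult_nonneg_nonneg)
qed simp

section \<open>Constants of the guarantee and numerical estimates for them\<close>

definition slow_rate :: real where "slow_rate = (3 - sqrt 5) / 2"
definition fast_rate :: real where "fast_rate = (3 + sqrt 5) / 2"
text \<open>The maximiser of \<open>exp (- a * x) - exp (- b * x)\<close> for the two rates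
  \<open>a\<close> and \<open>b\<close>, because \<open>b - a = sqrt 5\<close>.\<close>

definition stop_time :: real where "stop_time = ln (fast_rate / slow_rate) / sqrt 5"

lemma sqrt5_bounds: "2.236 < sqrt (5::real)" "sqrt (5::real) < 2.237"
proof -
  show "2.236 < sqrt (5::real)" by (rule real_less_rsqrt) (simp add: power2_eq_square)
  show "sqrt (5::real) < 2.237" by (rule real_less_lsqrt) (simp_all add: power2_eq_square)
qed

text \<open>The rates are the two roots of \<open>r^2 = 3 * r - 1\<close>. Writing everything in
  \<open>fast_rate\<close> reduces later goals to polynomial identities and one numerical
  interval.\<close>

lemma rates:
  "slow_rate = 3 - fast_rate" "fast_rate * fast_rate = 3 * fast_rate - 1"
  "sqrt 5 = 2 * fast_rate - 3" "slow_rate * fast_rate = 1"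
  by (auto simp: slow_rate_def fast_rate_def field_simps)

lemma fast_rate_bounds: "2.618 < fast_rate" "fast_rate < 2.6185"
  using sqrt5_bounds unfolding fast_rate_def by simp_all

lemma slow_rate_bounds: "0.3815 < slow_rate" "slow_rate < 0.382"
  using fast_rate_bounds unfolding rates(1) by simp_all

lemma rrg_const_eq: "rrg_const = (exp (- slow_rate * stop_time) - exp (- fast_rate * stop_time)) / sqrt 5"
  unfolding rrg_const_def slow_rate_def fast_rate_def stop_time_def Let_def by simp

lemma ln_rate_quotient: "ln (fast_rate / slow_rate) = 2 * ln fast_rate"
proof -
  have "fast_rate / slow_rate = fast_rate * fast_rate"
    using rates(4) slow_rate_bounds by (simp add: field_simps)
  then show ?thesis using fast_rate_bounds by (simp add: ln_mult)
qed

text \<open>Here \<open>13 / 12 = 1 / 2 + 1 / 3 + 1 / 4\<close>, the total length of the steps with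
  2, 3 and 4 elements to choose from.\<close>

lemma stop_time_upper: "stop_time \<le> 13 / 12"
proof -
  have "fast_rate \<le> 1 + 1.2 + 1.2\<^sup>2 / 2" using fast_rate_bounds by (simp add: power2_eq_square)
  also have "\<dots> \<le> exp (1.2::real)" by (rule exp_lower_Taylor_quadratic) simp
  finally have "ln fast_rate \<le> 1.2" using fast_rate_bounds ln_mono[of fast_rate "exp 1.2"] by simp
  then have "2 * ln fast_rate \<le> 13 / 12 * sqrt 5" using sqrt5_bounds by simp
  then show ?thesis unfolding stop_time_def ln_rate_quotient by (simp add: field_simps)
qed

lemma stop_time_lower: "2 / 5 \<le> stop_time"
proof -
  have "exp 1 \<le> fast_rate * fast_rate"
    using exp_le fast_rate_bounds unfolding rates(2) by simp
  then have "1 \<le> ln (fast_rate * fast_rate)"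
    using fast_rate_bounds by (subst ln_ge_iff) auto
  then have "1 \<le> 2 * ln fast_rate" using fast_rate_bounds by (simp add: ln_mult)
  then have "2 / 5 * sqrt 5 \<le> 2 * ln fast_rate" using sqrt5_bounds by simp
  then show ?thesis unfolding stop_time_def ln_rate_quotient by (simp add: field_simps)
qed

text \<open>At the maximiser \<open>exp (- b * x) = a^2 * exp (- a * x)\<close>, and
  \<open>1 - a^2 = sqrt 5 * a\<close>, so the constant equals \<open>a * exp (- a * x)\<close>. The
  bound \<open>1 / 3\<close> is what a single step guarantees for rank 3.\<close>

lemma rrg_const_le_third: "rrg_const \<le> 1 / 3"
proof -
  let ?z = "exp (- slow_rate * stop_time)"
  have "sqrt 5 * stop_time = ln (fast_rate / slow_rate)" unfolding stop_time_def by simp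
  then have "- fast_rate * stop_time = - slow_rate * stop_time - ln (fast_rate / slow_rate)"
    unfolding rates(1,3) by (simp add: algebra_simps)
  then have "exp (- fast_rate * stop_time) = ?z / (fast_rate / slow_rate)"
    using fast_rate_bounds slow_rate_bounds by (simp only: exp_diff) simp
  also have "\<dots> = ?z * (slow_rate * slow_rate)"
    using rates(4) fast_rate_bounds slow_rate_bounds by (simp add: field_simps)
  finally have "rrg_const = ?z * (1 - slow_rate * slow_rate) / sqrt 5"
    unfolding rrg_const_eq by (simp add: algebra_simps)
  also have "1 - slow_rate * slow_rate = sqrt 5 * slow_rate"
    using rates(2) unfolding rates(1,3) by (simp add: algebra_simps)
  finally have c: "rrg_const = slow_rate * ?z" by (simp add: mult.commute)
  have "1 + 2 / 5 * slow_rate \<le> 1 + slow_rate * stop_time"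
    using stop_time_lower slow_rate_bounds by (simp add: mult.commute mult_left_mono)
  also have "\<dots> \<le> exp (slow_rate * stop_time)" by (rule exp_ge_add_one_self)
  finally have "3 * slow_rate \<le> exp (slow_rate * stop_time)" using slow_rate_bounds by simp
  then show ?thesis unfolding c by (simp add: exp_minus field_simps)
qed

section \<open>Products of step factors\<close>

lemma bernoulli_powr:
  fixes p x :: real
  assumes p: "1 \<le> p" and x: "x < 1"
  shows "1 - p * x \<le> (1 - x) powr p"
proof (cases "1 - p * x > 0")
  case True
  \<comment> \<open>Weighted AM-GM for \<open>1 - p * x\<close> and \<open>1\<close> with weights
    \<open>1 / p\<close> and \<open>1 - 1 / p\<close>.\<close>
  have "(1 - p * x) powr (1 / p) * 1 powr (1 - 1 / p) \<le> 1 / p * (1 - p * x) + (1 - 1 / p) * 1"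
    using p True by (intro Youngs_inequality_0) auto
  also have "\<dots> = 1 - x" using p by (simp add: field_simps)
  finally have "((1 - p * x) powr (1 / p)) powr p \<le> (1 - x) powr p"
    using p by (intro powr_mono2) auto
  then show ?thesis using p True by (simp add: powr_powr)
next
  case False
  then show ?thesis using powr_ge_zero[of "1 - x" p] by linarith
qed

text \<open>Diagonalisation: \<open>(1, 0)\<close> is the sum of the eigenvectors
  \<open>(b - 1, 1) / sqrt 5\<close> and \<open>(1 - a, -1) / sqrt 5\<close> for \<open>-a\<close>
  and \<open>-b\<close>, and a step of length \<open>t\<close> scales them by
  \<open>1 - a * t\<close> and \<open>1 - b * t\<close>. The start vector amounts to a partial step
  of length \<open>s\<close>, at most \<open>1 / m\<close>.\<close>

lemma rrg_bound_closed_form: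
  assumes m: "1 \<le> m" "0 \<le> s" "s * real m \<le> 1" and n: "m \<le> n"
  defines "P \<equiv> \<lambda>r n. (1 - r * s) * (\<Prod>j\<in>{m<..n}. 1 - r / real j)"
  shows "rrg_bound n
    (((fast_rate - 1) * P slow_rate n + (1 - slow_rate) * P fast_rate n) / sqrt 5)
    ((P slow_rate n - P fast_rate n) / sqrt 5)"
  using n
proof (induction n rule: dec_induct)
  case base
  have "(fast_rate - 1) * (1 - slow_rate * s) + (1 - slow_rate) * (1 - fast_rate * s) = (1 - s) * sqrt 5"
    unfolding rates(1,3) by algebra
  moreover have "(1 - slow_rate * s) - (1 - fast_rate * s) = s * sqrt 5"
    unfolding rates(1,3) by algebra
  moreover have "P r m = 1 - r * s" for r unfolding P_def by simp
  ultimately show ?case using rrg_bound.start[OF m] by simp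
next
  case (step n)
  define x where "x = 1 / real (Suc n)"
  have PS: "P r (Suc n) = P r n * (1 - r * x)" for r
  proof -
    have "{m<..Suc n} = insert (Suc n) {m<..n}" using step by auto
    then show ?thesis unfolding P_def x_def by simp
  qed
  let ?A = "((fast_rate - 1) * P slow_rate n + (1 - slow_rate) * P fast_rate n) / sqrt 5"
  let ?B = "(P slow_rate n - P fast_rate n) / sqrt 5"
  have "rrg_bound (Suc n) (?A * (1 - x) + ?B * x) (?A * x + ?B * (1 - 2 * x))"
    using rrg_bound.step[OF _ step.IH] m step.hyps unfolding x_def by simp
  moreover have "?A * (1 - x) + ?B * x
    = ((fast_rate - 1) * P slow_rate (Suc n) + (1 - slow_rate) * P fast_rate (Suc n)) / sqrt 5"
  proof -
    have "((fast_rate - 1) * p + (1 - slow_rate) * q) * (1 - x) + (p - q) * x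
      = (fast_rate - 1) * (p * (1 - slow_rate * x)) + (1 - slow_rate) * (q * (1 - fast_rate * x))" for p q
      using rates(2) unfolding rates(1) by algebra
    from this[of "P slow_rate n" "P fast_rate n"] show ?thesis
      unfolding PS by (metis (no_types) add_divide_distrib times_divide_eq_left)
  qed
  moreover have "?A * x + ?B * (1 - 2 * x) = (P slow_rate (Suc n) - P fast_rate (Suc n)) / sqrt 5"
  proof -
    have "((fast_rate - 1) * p + (1 - slow_rate) * q) * x + (p - q) * (1 - 2 * x)
      = p * (1 - slow_rate * x) - q * (1 - fast_rate * x)" for p q
      unfolding rates(1) by algebra
    from this[of "P slow_rate n" "P fast_rate n"] show ?thesis
      unfolding PS by (metis (no_types) add_divide_distrib times_divide_eq_left)
  qed
  ultimately show ?case by simp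
qed

text \<open>A discrete intermediate value argument. The products over \<open>{m<..k}\<close>
  increase with \<open>m\<close> up to 1; at the least \<open>m\<close> where they reach
  \<open>z\<close>, the full step of length \<open>1 / m\<close> would overshoot, so a fraction of
  it hits \<open>z\<close> exactly. Requiring \<open>2 \<le> m\<close> leaves only factors with
  \<open>j \<ge> 3\<close>, for which \<open>1 - fast_rate / j\<close> is positive.\<close>

lemma fractional_steps_hit:
  fixes r z :: real
  assumes r: "0 < r" "r < 1" and z: "0 < z" "z \<le> 1" and low: "(\<Prod>j\<in>{1<..k}. 1 - r / real j) \<le> z"
    and k: "2 \<le> k"
  shows "\<exists>m s. 2 \<le> m \<and> m \<le> k \<and> 0 \<le> s \<and> s * real m \<le> 1 \<and> (1 - r * s) * (\<Prod>j\<in>{m<..k}. 1 - r / real j) = z"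
proof -
  define R where "R m = (\<Prod>j\<in>{m<..k}. 1 - r / real j)" for m
  have Rpos: "0 < R m" for m
    unfolding R_def using r by (intro prod_pos) (auto simp: field_simps)
  have RS: "R m = (1 - r / real (Suc m)) * R (Suc m)" if "m < k" for m
  proof -
    have "{m<..k} = insert (Suc m) {Suc m<..k}" using that by auto
    then show ?thesis unfolding R_def by simp
  qed
  define m where "m = (LEAST m. 2 \<le> m \<and> z \<le> R m)"
  have k': "2 \<le> k \<and> z \<le> R k" using k z unfolding R_def by simp
  have m: "2 \<le> m" "z \<le> R m" using LeastI[of "\<lambda>m. 2 \<le> m \<and> z \<le> R m", OF k'] unfolding m_def by auto
  have mk: "m \<le> k" unfolding m_def using k' by (rule Least_le)
  obtain m' where m': "m = Suc m'" "1 \<le> m'" using m by (cases m) auto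
  have "R m' \<le> z"
  \<comment> \<open>Minimality of \<open>m\<close> says nothing about index 1, so there the
    assumption \<open>low\<close> takes over.\<close>
  proof (cases "m' = 1")
    case True
    then show ?thesis using low unfolding R_def by simp
  next
    case False
    then have "\<not> (2 \<le> m' \<and> z \<le> R m')" using m' not_less_Least[of m' "\<lambda>m. 2 \<le> m \<and> z \<le> R m"] unfolding m_def by auto
    then show ?thesis using False m' by auto
  qed
  then have "(1 - r / real m) * R m \<le> z" using RS[of m'] m' mk by simp
  then have up: "1 - r / real m \<le> z / R m" using Rpos[of m] by (simp add: field_simps)
  define s where "s = (1 - z / R m) / r"
  have "0 \<le> s" unfolding s_def using m Rpos[of m] r by (simp add: field_simps)
  moreover have "s * real m \<le> 1"
    unfolding s_def using up r m by (simp add: field_simps)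
  moreover have "(1 - r * s) * R m = z" unfolding s_def using r Rpos[of m] by (simp add: field_simps)
  ultimately show ?thesis using m mk unfolding R_def by blast
qed

lemma rrg_bound_const: "\<exists>\<alpha> \<beta>. rrg_bound k \<alpha> \<beta> \<and> rrg_const \<le> \<beta>"
proof -
  consider "k = 0" | "1 \<le> k" "k \<le> 3" | "4 \<le> k" by linarith
  then show ?thesis
  proof cases
    case 1
    then show ?thesis using rrg_bound.zero rrg_const_le_third by force
  next
    case 2
    then have "rrg_bound k (1 - 1 / real k) (1 / real k)" by (intro rrg_bound.start) auto
    moreover have "rrg_const \<le> 1 / real k"
    proof -
      have "1 / 3 \<le> 1 / real k" using 2 by (intro divide_left_mono) auto
      then show ?thesis using rrg_const_le_third by linarith
    qed
    ultimately show ?thesis by blast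
  next
    case 3
    define a b z where "a = slow_rate" and "b = fast_rate" and "z = exp (- a * stop_time)"
    have ab: "0 < a" "a < 1" "b < 3" "1 \<le> b / a" "b / a * a = b"
      using slow_rate_bounds fast_rate_bounds unfolding a_def b_def by (auto simp: field_simps)
    \<comment> \<open>The factors for \<open>j = 2, 3, 4\<close> alone already push the product
      below \<open>z\<close>; this is why \<open>4 \<le> k\<close> is required.\<close>
    have "(\<Prod>j\<in>{1<..k}. 1 - a / real j) = (\<Prod>j\<in>{1<..4}. 1 - a / real j) * (\<Prod>j\<in>{4<..k}. 1 - a / real j)"
    proof -
      have "{1<..k} = {1<..4} \<union> {4<..k}" using 3 by auto
      then show ?thesis by (simp add: prod.union_disjoint)
    qed
    also have "\<dots> \<le> (\<Prod>j\<in>{1<..4}. exp (- (a / real j))) * 1"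
    proof (intro mult_mono prod_mono prod_le_1)
      fix j :: nat assume "j \<in> {4<..k}"
      then show "0 \<le> 1 - a / real j \<and> 1 - a / real j \<le> 1" using ab by (auto simp: field_simps)
    next
      fix j :: nat assume "j \<in> {1<..4}"
      then show "0 \<le> 1 - a / real j \<and> 1 - a / real j \<le> exp (- (a / real j))"
        using ab exp_ge_add_one_self[of "- (a / real j)"] by (auto simp: field_simps)
    next
      show "0 \<le> (\<Prod>j\<in>{4<..k}. 1 - a / real j)"
        using ab by (intro prod_nonneg) (auto simp: field_simps)
    qed (auto intro: prod_nonneg)
    also have "\<dots> = exp (- a * (13 / 12))"
    proof -
      have "{1<..4} = {2, 3, 4::nat}" by auto
      then show ?thesis by (simp add: exp_add[symmetric])
    qed
    also have "\<dots> \<le> z" unfolding z_def using stop_time_upper ab by simp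
    finally have low: "(\<Prod>j\<in>{1<..k}. 1 - a / real j) \<le> z" .
    have z1: "0 < z" "z \<le> 1" unfolding z_def using stop_time_lower ab by auto
    obtain m s where ms: "2 \<le> m" "m \<le> k" "0 \<le> s" "s * real m \<le> 1"
      and hit: "(1 - a * s) * (\<Prod>j\<in>{m<..k}. 1 - a / real j) = z"
      using fractional_steps_hit[OF ab(1,2) z1 low] 3 by auto
    have "1 \<le> m" using ms by simp
    define \<alpha> where "\<alpha> = ((b - 1) * ((1 - a * s) * (\<Prod>j\<in>{m<..k}. 1 - a / real j))
      + (1 - a) * ((1 - b * s) * (\<Prod>j\<in>{m<..k}. 1 - b / real j))) / sqrt 5"
    have bound: "rrg_bound k \<alpha> ((z - (1 - b * s) * (\<Prod>j\<in>{m<..k}. 1 - b / real j)) / sqrt 5)"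
      using rrg_bound_closed_form[OF \<open>1 \<le> m\<close> ms(3,4,2)] unfolding \<alpha>_def hit[symmetric] a_def b_def .
    have "s * 1 \<le> s * real m" using ms by (intro mult_left_mono) auto
    then have "s \<le> 1" using ms by linarith
    then have as: "a * s < 1" using mult_left_le[of s a] ab by linarith
    have bern: "1 - b * t \<le> (1 - a * t) powr (b / a)" if "a * t < 1" for t
      using bernoulli_powr[OF ab(4) that] ab(5) by (metis mult.assoc)
    \<comment> \<open>Bernoulli, factor by factor, with exponent \<open>b / a\<close>. The leading
      factor \<open>1 - b * s\<close> may be negative; monotonicity of the product only needs the
      factors with \<open>j \<ge> 3\<close> to be nonnegative.\<close>
    have "(1 - b * s) * (\<Prod>j\<in>{m<..k}. 1 - b / real j)
        \<le> (1 - a * s) powr (b / a) * (\<Prod>j\<in>{m<..k}. (1 - a / real j) powr (b / a))"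
    proof (intro mult_mono bern as prod_mono prod_nonneg)
      fix j assume "j \<in> {m<..k}"
      then have j: "3 \<le> j" using ms by simp
      then show "0 \<le> 1 - b / real j \<and> 1 - b / real j \<le> (1 - a / real j) powr (b / a)"
        using bern[of "1 / real j"] ab by (auto simp: field_simps)
      show "0 \<le> 1 - b / real j" using j ab by (auto simp: field_simps)
    qed auto
    also have "\<dots> = ((1 - a * s) * (\<Prod>j\<in>{m<..k}. 1 - a / real j)) powr (b / a)"
    proof -
      have "0 \<le> 1 - a / real j" if "j \<in> {m<..k}" for j using that ab by (auto simp: field_simps)
      then show ?thesis using as by (simp add: prod_powr_distrib powr_mult prod_nonneg)
    qed
    also have "\<dots> = exp (- b * stop_time)"
      unfolding hit unfolding z_def using ab by (simp add: powr_def)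
    finally have "rrg_const \<le> (z - (1 - b * s) * (\<Prod>j\<in>{m<..k}. 1 - b / real j)) / sqrt 5"
      unfolding rrg_const_eq z_def a_def b_def by (intro divide_right_mono) auto
    then show ?thesis using bound by blast
  qed
qed


subsection \<open>The padded matroid and the random run\<close>

lemma finite_pad_ground: "finite N \<Longrightarrow> finite (pad_ground N)"
  unfolding pad_ground_def by simp

lemma pad_indep_inj_fst: "pad_indep N I S \<Longrightarrow> inj_on fst S"
  unfolding pad_indep_def inj_on_def by (metis (full_types) prod.collapse)

lemma pad_indep_card: "pad_indep N I S \<Longrightarrow> card (fst ` S) = card S"
  by (rule card_image) (rule pad_indep_inj_fst)

text \<open>The projection is injective on independent sets, so an augmenting element found in
  \<open>I\<close> lifts to a copy lying in \<open>B\<close>.\<close>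

lemma matroid_padded:
  assumes m: "matroid N I" shows "matroid (pad_ground N) {S. pad_indep N I S}"
proof -
  have "finite (pad_ground N)" using m by (simp add: matroid_def finite_pad_ground)
  moreover have "pad_indep N I {}" using m unfolding pad_indep_def matroid_def by simp
  moreover have "pad_indep N I B" if "pad_indep N I A" "B \<subseteq> A" for A B
    using that matroid_subset[OF m, of "fst ` A" "fst ` B"] unfolding pad_indep_def by (auto simp: image_mono)
  moreover have "\<exists>x\<in>B - A. pad_indep N I (insert x A)"
    if A: "pad_indep N I A" and B: "pad_indep N I B" and c: "card A < card B" for A B
  proof -
    have "fst ` A \<in> I" "fst ` B \<in> I" using A B unfolding pad_indep_def by auto
    then obtain v where "v \<in> fst ` B - fst ` A" "insert v (fst ` A) \<in> I"
      using matroid_augment[OF m] c pad_indep_card[OF A] pad_indep_card[OF B] by metis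
    then obtain x where x: "x \<in> B" "fst x \<notin> fst ` A" "insert (fst x) (fst ` A) \<in> I" by auto
    have "pad_indep N I (insert x A)"
      using A B x unfolding pad_indep_def by (cases x) (auto simp: image_iff)
    then show ?thesis using x by blast
  qed
  moreover have "{S. pad_indep N I S} \<subseteq> Pow (pad_ground N)" unfolding pad_indep_def by blast
  ultimately show ?thesis unfolding matroid_def by simp
qed

definition dummy :: "'a \<times> bool \<Rightarrow> 'a \<times> bool" where
  "dummy x = (fst x, True)"

text \<open>Replacing elements by their dummies does not change the projection, which determines
  both independence and cardinality. Dummies already in \<open>C\<close> are fixed by
  \<open>dummy\<close>.\<close>

lemma pad_indep_discard:
  assumes T: "pad_indep N I T" and C: "C \<subseteq> T"
  shows "pad_indep N I ((T - C) \<union> dummy ` C)"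
    and "card ((T - C) \<union> dummy ` C) = card T"
    and "orig ((T - C) \<union> dummy ` C) = orig (T - C)"
proof -
  have "fst ` dummy ` C = fst ` C" unfolding dummy_def by (simp add: image_image)
  then have fst: "fst ` ((T - C) \<union> dummy ` C) = fst ` T" using C by blast
  show indep: "pad_indep N I ((T - C) \<union> dummy ` C)"
    unfolding pad_indep_def fst
  proof (intro conjI allI)
    have "dummy x \<in> pad_ground N" if "x \<in> pad_ground N" for x
      using that unfolding pad_ground_def dummy_def by auto
    then show "T - C \<union> dummy ` C \<subseteq> pad_ground N" using T C unfolding pad_indep_def by blast
    show "fst ` T \<in> I" using T unfolding pad_indep_def by blast
    fix u show "\<not> ((u, False) \<in> T - C \<union> dummy ` C \<and> (u, True) \<in> T - C \<union> dummy ` C)"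
    proof
      assume "(u, False) \<in> T - C \<union> dummy ` C \<and> (u, True) \<in> T - C \<union> dummy ` C"
      then have u: "(u, False) \<in> T" "(u, False) \<notin> C" "(u, True) \<in> T \<or> (\<exists>b. (u, b) \<in> C)"
        unfolding dummy_def by auto
      have "(u, True) \<in> T"
      proof (rule ccontr)
        assume "(u, True) \<notin> T"
        then obtain b where "(u, b) \<in> C" using u(3) by blast
        then show False using u(2) C \<open>(u, True) \<notin> T\<close> by (cases b) auto
      qed
      then show False using T u(1) unfolding pad_indep_def by blast
    qed
  qed
  show "card ((T - C) \<union> dummy ` C) = card T"
    using pad_indep_card[OF indep] pad_indep_card[OF T] fst by simp
  show "orig ((T - C) \<union> dummy ` C) = orig (T - C)"
    unfolding orig_def dummy_def by auto
qed

lemma mrank_padded: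
  assumes m: "matroid N I" shows "mrank {S. pad_indep N I S} = mrank I"
proof -
  have "card ` {S. pad_indep N I S} = card ` I"
  proof (intro equalityI subsetI)
    fix n assume "n \<in> card ` {S. pad_indep N I S}"
    then obtain S where S: "pad_indep N I S" "n = card S" by auto
    then have "n = card (fst ` S)" "fst ` S \<in> I" using pad_indep_card[OF S(1)] unfolding pad_indep_def by auto
    then show "n \<in> card ` I" by blast
  next
    fix n assume "n \<in> card ` I"
    then obtain A where A: "A \<in> I" "n = card A" by auto
    then have "A \<subseteq> N" using matroid_ground[OF m] by blast
    then have S: "pad_indep N I (A \<times> {False})"
      using A unfolding pad_indep_def pad_ground_def by (auto simp: image_iff)
    have "card (A \<times> {False}) = n" using A by (simp add: card_cartesian_product)
    then show "n \<in> card ` {S. pad_indep N I S}" using S by blast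
  qed
  then show ?thesis unfolding mrank_def by simp
qed

lemma orig_simps: "orig (A \<union> B) = orig A \<union> orig B" "orig (A \<inter> B) = orig A \<inter> orig B"
  unfolding orig_def by auto

lemma orig_subset: "A \<subseteq> pad_ground N \<Longrightarrow> orig A \<subseteq> N"
  unfolding orig_def pad_ground_def by auto

section \<open>The run of the algorithm on the padded matroid\<close>

locale rrg =
  fixes N :: "'a set" and I :: "'a set set" and f :: "'a set \<Rightarrow> real"
    and sel :: "('a \<times> bool) list \<Rightarrow> ('a \<times> bool) set"
  assumes matroid: "matroid N I"
    and nonneg: "\<And>S. S \<subseteq> N \<Longrightarrow> f S \<ge> 0"
    and submodular: "submodular_on N f"
    and valid: "valid_rrg_choice N I f sel"
begin

sublocale padded: discardable_matroid "pad_ground N" "{S. pad_indep N I S}" "pad_f f"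
proof
  show "matroid (pad_ground N) {S. pad_indep N I S}" by (rule matroid_padded[OF matroid])
  show "0 \<le> pad_f f A" if "A \<subseteq> pad_ground N" for A
    using nonneg orig_subset[OF that] unfolding pad_f_def by blast
  show "submodular_on (pad_ground N) (pad_f f)"
    unfolding submodular_on_def pad_f_def orig_simps
    using submodular_onD[OF submodular] orig_subset by blast
  show "\<exists>T'\<in>{S. pad_indep N I S}. T - C \<subseteq> T' \<and> card T' = card T \<and> pad_f f T' = pad_f f (T - C)"
    if "T \<in> {S. pad_indep N I S}" "C \<subseteq> T" for T C
    using pad_indep_discard[of N I T C] that unfolding pad_f_def
    by (intro bexI[of _ "(T - C) \<union> dummy ` C"]) auto
qed

lemma mem_bases_above:
  "T \<in> padded.bases_above S \<longleftrightarrow> pad_indep N I T \<and> S \<subseteq> T \<and> card T = mrank I"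
  unfolding padded.bases_above_def mrank_padded[OF matroid] by simp

text \<open>\<open>contr_base\<close> is defined by maximality; augmenting from a base of full rank
  shows that this amounts to having cardinality \<open>mrank I\<close> together with
  \<open>S\<close>.\<close>

lemma contr_base_iff:
  "contr_base N I S B \<longleftrightarrow> B \<inter> S = {} \<and> S \<union> B \<in> padded.bases_above S"
proof
  assume B: "contr_base N I S B"
  then have SB: "pad_indep N I (S \<union> B)" and dis: "B \<inter> S = {}"
    unfolding contr_base_def by (auto simp: Un_commute)
  have "card (S \<union> B) = mrank I"
  proof (rule ccontr)
    assume ne: "card (S \<union> B) \<noteq> mrank I"
    have "card (S \<union> B) \<le> mrank I"
      using card_le_mrank[OF padded.matroid, of "S \<union> B"] SB mrank_padded[OF matroid] by simp
    with ne have less: "card (S \<union> B) < mrank I" by simp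
    obtain X where X: "pad_indep N I X" "card X = mrank I"
      using mrank_attained[OF padded.matroid] mrank_padded[OF matroid] by auto
    then obtain x where x: "x \<in> X - (S \<union> B)" "pad_indep N I (insert x (S \<union> B))"
      using matroid_augment[OF padded.matroid, of "S \<union> B" X] SB less by auto
    then have "x \<in> pad_ground N - S - B" unfolding pad_indep_def by auto
    then show False using B x unfolding contr_base_def by (auto simp: Un_commute)
  qed
  then show "B \<inter> S = {} \<and> S \<union> B \<in> padded.bases_above S"
    using dis SB by (simp add: mem_bases_above)
next
  assume B: "B \<inter> S = {} \<and> S \<union> B \<in> padded.bases_above S"
  then have SB: "pad_indep N I (B \<union> S)" "card (B \<union> S) = mrank I"
    by (auto simp: mem_bases_above Un_commute)
  have "\<not> pad_indep N I (insert x (B \<union> S))" if x: "x \<in> pad_ground N - S - B" for x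
  proof
    assume "pad_indep N I (insert x (B \<union> S))"
    then have "card (insert x (B \<union> S)) \<le> mrank I"
      using card_le_mrank[OF padded.matroid, of "insert x (B \<union> S)"] mrank_padded[OF matroid] by simp
    moreover have "finite (B \<union> S)" using matroid_finite[OF padded.matroid] SB by blast
    ultimately show False using x SB by auto
  qed
  moreover have "B \<subseteq> pad_ground N - S" using B SB unfolding pad_indep_def by auto
  ultimately show "contr_base N I S B" using SB unfolding contr_base_def by auto
qed

text \<open>The invariant of the run, indexed by the number of steps still to come, as in
  \<open>rrg_run\<close>.\<close>

definition history :: "nat \<Rightarrow> ('a \<times> bool) list \<Rightarrow> bool" where
  "history n h \<longleftrightarrow> distinct h \<and> pad_indep N I (set h) \<and> length h + n = mrank I"

definition expected_value :: "nat \<Rightarrow> ('a \<times> bool) list \<Rightarrow> real" where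
  "expected_value n h = measure_pmf.expectation (rrg_run sel n h) (\<lambda>h. pad_f f (set h))"

lemma sel_base:
  assumes h: "history (Suc n) h"
  shows "sel h \<inter> set h = {}" "set h \<union> sel h \<in> padded.bases_above (set h)"
    and "card (sel h) = Suc n" "finite (sel h)" "(set h \<union> sel h) - set h = sel h"
proof -
  have "contr_base N I (set h) (sel h)"
    using h valid unfolding history_def valid_rrg_choice_def by simp
  then show dis: "sel h \<inter> set h = {}" and base: "set h \<union> sel h \<in> padded.bases_above (set h)"
    unfolding contr_base_iff by auto
  then show "(set h \<union> sel h) - set h = sel h" by auto
  have SB: "pad_indep N I (set h \<union> sel h)" "card (set h \<union> sel h) = mrank I"
    using base by (auto simp: mem_bases_above)
  then show fin: "finite (sel h)" using matroid_finite[OF padded.matroid, of "set h \<union> sel h"] by simp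
  have "card (set h \<union> sel h) = card (set h) + card (sel h)"
    using fin dis by (intro card_Un_disjoint) auto
  then show "card (sel h) = Suc n"
    using SB h distinct_card[of h] unfolding history_def by simp
qed

lemma history_Cons:
  assumes h: "history (Suc n) h" and u: "u \<in> sel h"
  shows "history n (u # h)"
proof -
  have "pad_indep N I (set h \<union> sel h)" using sel_base(2)[OF h] by (simp add: mem_bases_above)
  then have "pad_indep N I (insert u (set h))"
    using matroid_subset[OF padded.matroid, of "set h \<union> sel h" "insert u (set h)"] u by auto
  then show ?thesis using h u sel_base(1)[OF h] unfolding history_def by auto
qed

text \<open>Finite support turns the expectation of a bind into a finite average.\<close>

lemma finite_rrg_run: "history n h \<Longrightarrow> finite (set_pmf (rrg_run sel n h))"
proof (induction n arbitrary: h)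
  case (Suc n)
  then have "finite (sel h)" "sel h \<noteq> {}" using sel_base(3,4)[OF Suc.prems] by auto
  then show ?case using Suc.IH history_Cons[OF Suc.prems] by simp
qed simp

lemma expected_value_Suc:
  assumes h: "history (Suc n) h"
  shows "expected_value (Suc n) h = (\<Sum>u\<in>sel h. expected_value n (u # h)) / real (Suc n)"
proof -
  have "finite (sel h)" "sel h \<noteq> {}" using sel_base(3,4)[OF h] by auto
  then show ?thesis
    unfolding expected_value_def rrg_run.simps
    using finite_rrg_run[OF history_Cons[OF h]] sel_base(3)[OF h]
    by (subst pmf_expectation_bind_pmf_of_set) (auto simp: sum_distrib_left divide_inverse mult.commute)
qed

lemma sum_value_step:
  assumes h: "history (Suc n) h"
  shows "real n * pad_f f (set h) + padded.opt_above (set h) \<le> (\<Sum>u\<in>sel h. pad_f f (set (u # h)))"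
proof -
  have "(real (card ((set h \<union> sel h) - set h)) - 1) * pad_f f (set h) + padded.opt_above (set h)
      \<le> (\<Sum>u\<in>(set h \<union> sel h) - set h. pad_f f (insert u (set h)))"
  proof (rule padded.sum_greedy_ge[OF sel_base(2)[OF h]])
    fix Y assume Y: "Y \<in> padded.bases_above (set h)"
    then have "set h \<subseteq> Y" by (simp add: mem_bases_above)
    then have "set h \<union> (Y - set h) = Y" by blast
    then have "contr_base N I (set h) (Y - set h)"
      unfolding contr_base_iff using Y by (simp del: Un_Diff_cancel) blast
    then have "marg_weight f (set h) (Y - set h) \<le> marg_weight f (set h) (sel h)"
      using h valid unfolding history_def valid_rrg_choice_def by simp
    then show "(\<Sum>u\<in>Y - set h. pad_f f (insert u (set h)) - pad_f f (set h))
      \<le> (\<Sum>u\<in>(set h \<union> sel h) - set h. pad_f f (insert u (set h)) - pad_f f (set h))"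
      unfolding marg_weight_def sel_base(5)[OF h] .
  qed
  then show ?thesis unfolding sel_base(3,5)[OF h] by simp
qed

lemma sum_opt_step:
  assumes h: "history (Suc n) h"
  shows "(real n - 1) * padded.opt_above (set h) + pad_f f (set h)
    \<le> (\<Sum>u\<in>sel h. padded.opt_above (set (u # h)))"
  using padded.sum_opt_above_ge[OF sel_base(2)[OF h]] unfolding sel_base(3,5)[OF h] by simp

text \<open>Justifies starting from \<open>(1, 0)\<close> with any number of steps left: since
  \<open>H(S) \<ge> f(S)\<close>, no step lowers the value in expectation.\<close>

lemma expected_value_ge: "history n h \<Longrightarrow> pad_f f (set h) \<le> expected_value n h"
proof (induction n arbitrary: h)
  case 0
  then show ?case by (simp add: expected_value_def)
next
  case (Suc n)
  have "pad_f f (set h) \<le> padded.opt_above (set h)"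
    using Suc.prems by (intro padded.opt_above_ge_self) (simp add: history_def)
  then have "real (Suc n) * pad_f f (set h) \<le> (\<Sum>u\<in>sel h. pad_f f (set (u # h)))"
    using sum_value_step[OF Suc.prems] by (simp add: algebra_simps)
  also have "\<dots> \<le> (\<Sum>u\<in>sel h. expected_value n (u # h))"
    by (intro sum_mono Suc.IH history_Cons[OF Suc.prems])
  finally show ?case unfolding expected_value_Suc[OF Suc.prems] by (simp add: field_simps)
qed

lemma expected_value_lower:
  assumes "rrg_bound n \<alpha> \<beta>" "history n h"
  shows "\<alpha> * pad_f f (set h) + \<beta> * padded.opt_above (set h) \<le> expected_value n h"
  using assms
proof (induction arbitrary: h rule: rrg_bound.induct)
  case zero
  then have h: "pad_indep N I (set h)" "card (set h) = mrank I"
    using distinct_card[of h] unfolding history_def by auto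
  then obtain T where T: "T \<in> padded.bases_above (set h)" "padded.opt_above (set h) = pad_f f T"
    using padded.opt_above_attained[of "set h"] by auto
  \<comment> \<open>With no steps left the picked set is a base, hence the only base above
    itself.\<close>
  have "set h = T"
    using T(1) h matroid_finite[OF padded.matroid, of T]
    by (intro card_subset_eq) (auto simp: mem_bases_above)
  then show ?case using T by (simp add: expected_value_def)
next
  case (start n s)
  obtain n' where n: "n = Suc n'" using start by (cases n) auto
  have "real n' * pad_f f (set h) + padded.opt_above (set h) \<le> (\<Sum>u\<in>sel h. pad_f f (set (u # h)))"
    using sum_value_step start.prems n by blast
  also have "\<dots> \<le> (\<Sum>u\<in>sel h. expected_value n' (u # h))"
    using start.prems n by (intro sum_mono expected_value_ge history_Cons) auto
  also have "\<dots> = real n * expected_value n h"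
    using expected_value_Suc[of n' h] start.prems n by simp
  finally have "padded.opt_above (set h) - pad_f f (set h) \<le> real n * (expected_value n h - pad_f f (set h))"
    unfolding n by (simp add: algebra_simps)
  \<comment> \<open>The next step gains at least \<open>(H(S) - f(S)) / n\<close>. Only the fraction
    \<open>s * n\<close> of the nonnegative expected gain is kept, which is what mixing the start
    vectors means.\<close>
  then have "s * (padded.opt_above (set h) - pad_f f (set h))
      \<le> (s * real n) * (expected_value n h - pad_f f (set h))"
    using start.hyps by (metis mult.assoc mult_left_mono)
  also have "\<dots> \<le> 1 * (expected_value n h - pad_f f (set h))"
    using start.hyps expected_value_ge[OF start.prems] by (intro mult_right_mono) auto
  finally show ?case by (simp add: algebra_simps)
next
  case (step n \<alpha> \<beta>)
  let ?F = "pad_f f (set h)" and ?H = "padded.opt_above (set h)"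
  have nn: "0 \<le> \<alpha>" "0 \<le> \<beta>" using rrg_bound_nonneg[OF step.hyps(2)] by auto
  have "\<alpha> * (real n * ?F + ?H) + \<beta> * ((real n - 1) * ?H + ?F)
      \<le> \<alpha> * (\<Sum>u\<in>sel h. pad_f f (set (u # h))) + \<beta> * (\<Sum>u\<in>sel h. padded.opt_above (set (u # h)))"
    using nn sum_value_step[OF step.prems] sum_opt_step[OF step.prems]
    by (intro add_mono mult_left_mono) auto
  also have "\<dots> = (\<Sum>u\<in>sel h. \<alpha> * pad_f f (set (u # h)) + \<beta> * padded.opt_above (set (u # h)))"
    by (simp add: sum.distrib sum_distrib_left)
  also have "\<dots> \<le> (\<Sum>u\<in>sel h. expected_value n (u # h))"
    by (intro sum_mono step.IH history_Cons[OF step.prems])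
  finally have "(\<alpha> * (real n * ?F + ?H) + \<beta> * ((real n - 1) * ?H + ?F)) / real (Suc n)
      \<le> expected_value (Suc n) h"
    unfolding expected_value_Suc[OF step.prems] by (intro divide_right_mono) auto
  moreover have "(\<alpha> * (1 - 1 / real (Suc n)) + \<beta> / real (Suc n)) * ?F
      + (\<alpha> / real (Suc n) + \<beta> * (1 - 2 / real (Suc n))) * ?H
    = (\<alpha> * (real n * ?F + ?H) + \<beta> * ((real n - 1) * ?H + ?F)) / real (Suc n)"
  proof -
    have "1 - 1 / real (Suc n) = real n / real (Suc n)"
      "1 - 2 / real (Suc n) = (real n - 1) / real (Suc n)" by (simp_all add: field_simps)
    then show ?thesis by (simp only:) (simp add: add_divide_distrib diff_divide_distrib algebra_simps)
  qed
  ultimately show ?case by simp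
qed

text \<open>An independent set need not be a base, but dummies complete its copy to a padded base of
  the same value.\<close>

lemma opt_above_empty_ge:
  assumes A: "A \<in> I" shows "f A \<le> padded.opt_above {}"
proof -
  have "A \<subseteq> N" by (rule matroid_ground[OF matroid A])
  then have indep: "pad_indep N I (A \<times> {False})"
    using A unfolding pad_indep_def pad_ground_def by (auto simp: image_iff)
  have "f A = pad_f f (A \<times> {False})" unfolding pad_f_def orig_def by simp
  also have "\<dots> \<le> padded.opt_above (A \<times> {False})"
    using indep by (intro padded.opt_above_ge_self) simp
  also have "\<dots> \<le> padded.opt_above {}"
  proof -
    obtain T where "T \<in> padded.bases_above (A \<times> {False})"
      "padded.opt_above (A \<times> {False}) = pad_f f T"
      using padded.opt_above_attained[of "A \<times> {False}"] indep by auto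
    then show ?thesis using padded.opt_above_ge[of T "{}"] by (simp add: mem_bases_above)
  qed
  finally show ?thesis .
qed

lemma approximation: "rrg_const * Max (f ` I) \<le> measure_pmf.expectation (rrg_output I sel) f"
proof -
  have I: "{} \<in> I" using matroid unfolding matroid_def by blast
  have "history (mrank I) []"
    using I unfolding history_def pad_indep_def by simp
  moreover obtain \<alpha> \<beta> where b: "rrg_bound (mrank I) \<alpha> \<beta>" "rrg_const \<le> \<beta>"
    using rrg_bound_const by blast
  ultimately have "\<alpha> * pad_f f {} + \<beta> * padded.opt_above {} \<le> expected_value (mrank I) []"
    using expected_value_lower[of "mrank I" \<alpha> \<beta> "[]"] by simp
  moreover have "0 \<le> \<alpha> * pad_f f {}"
    using rrg_bound_nonneg[OF b(1)] padded.nonneg[of "{}"] by simp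
  moreover have "rrg_const * Max (f ` I) \<le> \<beta> * padded.opt_above {}"
  proof -
    have "Max (f ` I) \<in> f ` I" using I matroid_finite_indep[OF matroid] by (intro Max_in) auto
    then obtain A where A: "A \<in> I" "Max (f ` I) = f A" by auto
    moreover have "0 \<le> f A" by (rule nonneg[OF matroid_ground[OF matroid A(1)]])
    ultimately have "rrg_const * Max (f ` I) \<le> \<beta> * f A" using b by (simp add: mult_right_mono)
    also have "\<dots> \<le> \<beta> * padded.opt_above {}"
      using rrg_bound_nonneg[OF b(1)] opt_above_empty_ge[OF A(1)] by (intro mult_left_mono) auto
    finally show ?thesis .
  qed
  moreover have "measure_pmf.expectation (rrg_output I sel) f = expected_value (mrank I) []"
    unfolding rrg_output_def expected_value_def pad_f_def by simp
  ultimately show ?thesis by linarith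
qed

end

theorem theorem4:
  fixes N :: "'a set" and I :: "'a set set" and f :: "'a set \<Rightarrow> real"
    and sel :: "('a \<times> bool) list \<Rightarrow> ('a \<times> bool) set"
  assumes "matroid N I"
    and "\<And>S. S \<subseteq> N \<Longrightarrow> f S \<ge> 0"
    and "submodular_on N f"
    and "valid_rrg_choice N I f sel"
  shows "measure_pmf.expectation (rrg_output I sel) f \<ge> rrg_const * Max (f ` I)"
  using assms by (intro rrg.approximation rrg.intro)

end
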